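(* Let $\lambda>0$, $\alpha>0$, let $\mu>0$ be the lowest eigenvalue of $\mathbf{J}$, and let $\delta_0,\nu_0>0$ satisfy $\delta_0\nu_0\|\mathbf{D}\|^2<1$. Let $\boldsymbol{v}^{[0]},\boldsymbol{h}^{[0]}\in\mathbb{R}^{|\Upsilon|}$ be arbitrary, $\boldsymbol{u}^{[0]}=\bar{\boldsymbol{u}}^{[0]}=\mathbf{D}\boldsymbol{v}^{[0]}$, $\boldsymbol{\ell}^{[0]}=\bar{\boldsymbol{\ell}}^{[0]}=\mathbf{D}\boldsymbol{h}^{[0]}$. For $t=0,1,2,\dots$ define $$\begin{pmatrix}\boldsymbol{v}^{[t+1]}\\ \boldsymbol{h}^{[t+1]}\end{pmatrix}=\mathrm{prox}_{\delta_t\Phi}\left(\begin{pmatrix}\boldsymbol{v}^{[t]}\\ \boldsymbol{h}^{[t]}\end{pmatrix}-\delta_t\begin{pmatrix}\mathbf{D}^*\bar{\boldsymbol{u}}^{[t]}\\ \mathbf{D}^*\bar{\boldsymbol{\ell}}^{[t]}\end{pmatrix}\right),$$ $$\boldsymbol{u}^{[t+1]}=\mathrm{prox}_{\nu_t(\lambda\|\cdot\|_{2,1})^*}\big(\boldsymbol{u}^{[t]}+\nu_t\mathbf{D}\boldsymbol{v}^{[t+1]}\big),\qquad \boldsymbol{\ell}^{[t+1]}=\mathrm{prox}_{\nu_t(\lambda\alpha\|\cdot\|_{2,1})^*}\big(\boldsymbol{\ell}^{[t]}+\nu_t\mathbf{D}\boldsymbol{h}^{[t+1]}\big),$$ $$\vartheta_t=(1+2\mu\delta_t)^{-1/2},\qquad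 \delta_{t+1}=\vartheta_t\delta_t,\qquad \nu_{t+1}=\nu_t/\vartheta_t,$$ $$\begin{pmatrix}\bar{\boldsymbol{u}}^{[t+1]}\\ \bar{\boldsymbol{\ell}}^{[t+1]}\end{pmatrix}=\begin{pmatrix}\boldsymbol{u}^{[t+1]}\\ \boldsymbol{\ell}^{[t+1]}\end{pmatrix}+\vartheta_t\left(\begin{pmatrix}\boldsymbol{u}^{[t+1]}\\ \boldsymbol{\ell}^{[t+1]}\end{pmatrix}-\begin{pmatrix}\boldsymbol{u}^{[t]}\\ \boldsymbol{\ell}^{[t]}\end{pmatrix}\right).$$ Then the sequence $(\boldsymbol{v}^{[t]},\boldsymbol{h}^{[t]})_{t\in\mathbb{N}}$ converges to a solution of the joint estimation problem $$\underset{(\boldsymbol{v},\boldsymbol{h})\in\mathbb{R}^{|\Upsilon|}\times\mathbb{R}^{|\Upsilon|}}{\arg\min}\ \Phi(\boldsymbol{v},\boldsymbol{h};\boldsymbol{\mathcal{L}})+\lambda\big(\|\mathbf{D}\boldsymbol{v}\|_{2,1}+\alpha\|\mathbf{D}\boldsymbol{h}\|_{2,1}\big).$$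
   Context: Let $N\geq 2$, $\Upsilon=\{1,\dots,N\}^2$, and let $j_1<j_2$ be positive integers; all sums $\sum_j$ are over $j\in\{j_1,\dots,j_2\}$. For each $j$ let $\boldsymbol{\mathcal{L}}_j=(\mathcal{L}_{j,\underline{n}})_{\underline{n}\in\Upsilon}$ be given with $\mathcal{L}_{j,\underline{n}}>0$; $\log_2$ acts entrywise. Set $R_m=\sum_j j^m$, $\mathbf{J}=\begin{pmatrix}R_0&R_1\\R_1&R_2\end{pmatrix}$ (symmetric positive definite), and $$\Phi(\boldsymbol{v},\boldsymbol{h})=\Phi(\boldsymbol{v},\boldsymbol{h};\boldsymbol{\mathcal{L}})=\frac12\sum_j\|\boldsymbol{v}+j\boldsymbol{h}-\log_2\boldsymbol{\mathcal{L}}_j\|_{\mathrm{Fro}}^2 .$$ The operator $\mathbf{D}:\mathbb{R}^{|\Upsilon|}\to\mathbb{R}^{2\times|\Upsilon|}$ is given by $(\mathbf{D}\boldsymbol{h})_{n_1,n_2}=\begin{pmatrix}h_{n_1,n_2+1}-h_{n_1,n_2}\\ h_{n_1+1,n_2}-h_{n_1,n_2}\end{pmatrix}$ for $1\le n_1,n_2\le N-1$, and $(\mathbf{D}\boldsymbol{h})_{n_1,n_2}=0$ if $n_1=N$ or $n_2=N$. $\mathbf{D}^*$ is its adjoint and $\|\mathbf{D}\|$ its operator norm for Euclidean norms. For $\boldsymbol{z}=(\boldsymbol{z}_1,\dots,\boldsymbol{z}_I)\in\mathbb{R}^{I\times|\Upsilon|}$, $$\|\boldsymbol{z}\|_{2,1}=\sum_{n_1=1}^{N-1}\sum_{n_2=1}^{N-1}\sqrt{\sum_{i=1}^I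 (z_i)_{n_1,n_2}^2}.$$ $\varphi^*$ denotes the Fenchel conjugate of $\varphi$, and $\mathrm{prox}_{\gamma\varphi}(x)=\arg\min_y \frac12\|x-y\|_2^2+\gamma\varphi(y)$ for $\gamma>0$. *)

theory Defs
  imports "HOL-Analysis.Analysis"
begin

text \<open>
  An image on the grid \<open>{1..N} \<times> {1..N}\<close> is an element \<open>x\<close> of \<open>real ^ 'n ^ 'n\<close>, the pixel
  \<open>(n1, n2)\<close> being \<open>x $ n1 $ n2\<close>. The index type \<open>'n\<close> is finite and linearly ordered with
  \<open>N = CARD('n)\<close>, so it is order-isomorphic to \<open>{1..N}\<close>; \<open>last_index\<close> plays the role of \<open>N\<close> and
  \<open>next_index n\<close> that of \<open>n + 1\<close> (it is only meaningful for \<open>n \<noteq> last_index\<close>).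
  A stack of images indexed by \<open>'i\<close> is an element of \<open>'n image ^ 'i\<close>. On all these types the
  library norm is the Euclidean norm of all the entries (for images: the Frobenius norm).
\<close>

type_synonym 'n image = "((real, 'n) vec, 'n) vec"

definition last_index :: "'n::{finite,linorder}" where
  "last_index = Max UNIV"

definition next_index :: "'n::{finite,linorder} \<Rightarrow> 'n" where
  "next_index n = Min {n<..}"

definition discrete_grad :: "'n::{finite,linorder} image \<Rightarrow> 'n image ^ 2" where
  "discrete_grad h = vector
    [\<chi> n1 n2. if n1 = last_index \<or> n2 = last_index then 0
              else h $ n1 $ next_index n2 - h $ n1 $ n2,
     \<chi> n1 n2. if n1 = last_index \<or> n2 = last_index then 0
              else h $ next_index n1 $ n2 - h $ n1 $ n2]"

text \<open>The last row and column do not contribute, so this is only a seminorm.\<close>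

definition mixed_norm :: "'n::{finite,linorder} image ^ 'i \<Rightarrow> real" where
  "mixed_norm z = (\<Sum>n1\<in>UNIV - {last_index}. \<Sum>n2\<in>UNIV - {last_index}.
     sqrt (\<Sum>i\<in>UNIV. (z $ i $ n1 $ n2)\<^sup>2))"

definition log2_image :: "'n::finite image \<Rightarrow> 'n image" where
  "log2_image x = (\<chi> n1 n2. log 2 (x $ n1 $ n2))"

definition data_fidelity ::
  "nat \<Rightarrow> nat \<Rightarrow> (nat \<Rightarrow> 'n::finite image) \<Rightarrow> 'n image \<Rightarrow> 'n image \<Rightarrow> real" where
  "data_fidelity j1 j2 L v h =
     1 / 2 * (\<Sum>j=j1..j2. (norm (v + real j *\<^sub>R h - log2_image (L j)))\<^sup>2)"

definition scale_moment :: "nat \<Rightarrow> nat \<Rightarrow> nat \<Rightarrow> real" where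
  "scale_moment j1 j2 m = (\<Sum>j=j1..j2. real j ^ m)"

definition scale_matrix :: "nat \<Rightarrow> nat \<Rightarrow> real ^ 2 ^ 2" where
  "scale_matrix j1 j2 = vector
    [vector [scale_moment j1 j2 0, scale_moment j1 j2 1],
     vector [scale_moment j1 j2 1, scale_moment j1 j2 2]]"

definition eigenvalue :: "real ^ 'm ^ 'm \<Rightarrow> real \<Rightarrow> bool" where
  "eigenvalue A k \<longleftrightarrow> (\<exists>x. x \<noteq> 0 \<and> A *v x = k *s x)"

definition lowest_eigenvalue :: "real ^ 'm ^ 'm \<Rightarrow> real \<Rightarrow> bool" where
  "lowest_eigenvalue A k \<longleftrightarrow> eigenvalue A k \<and> (\<forall>k'. eigenvalue A k' \<longrightarrow> k \<le> k')"

definition fenchel_conjugate :: "('a::real_inner \<Rightarrow> ereal) \<Rightarrow> 'a \<Rightarrow> ereal" where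
  "fenchel_conjugate \<phi> y = (SUP x. ereal (x \<bullet> y) - \<phi> x)"

text \<open>
  Functions are extended-real valued because the conjugate of a seminorm takes the value infinity.
  The minimizer is unique whenever \<open>\<phi>\<close> is proper, convex and lower semicontinuous and \<open>\<gamma> > 0\<close>;
  otherwise the value is arbitrary.
\<close>

definition prox :: "real \<Rightarrow> ('a::real_inner \<Rightarrow> ereal) \<Rightarrow> 'a \<Rightarrow> 'a" where
  "prox \<gamma> \<phi> x = (ARG_MIN (\<lambda>y. ereal (1 / 2 * (norm (x - y))\<^sup>2) + ereal \<gamma> * \<phi> y) y. True)"

definition joint_objective ::
  "nat \<Rightarrow> nat \<Rightarrow> (nat \<Rightarrow> 'n::{finite,linorder} image) \<Rightarrow> real \<Rightarrow> real \<Rightarrow>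
     ('n image) \<times> ('n image) \<Rightarrow> real" where
  "joint_objective j1 j2 L lam \<alpha> = (\<lambda>(v, h). data_fidelity j1 j2 L v h
     + lam * (mixed_norm (discrete_grad v) + \<alpha> * mixed_norm (discrete_grad h)))"

end

theory Submission
  imports Defs
begin

text \<open>
  Writing \<open>x = (v, h)\<close>, \<open>y = (u, l)\<close> and \<open>K\<close> for the discrete gradient acting on both components, the
  problem is to minimize \<open>\<Phi> x + F (K x)\<close>, where \<open>\<Phi>\<close> is a quadratic whose Hessian is bounded below by
  the smallest eigenvalue \<open>\<mu>\<close> of the matrix of scale moments (\<open>fidelity_hessian_coercive\<close>), and \<open>F\<close>
  is a weighted sum of mixed norms. Since \<open>F\<close> is nonnegative, positively homogeneous and continuous,
  its conjugate is the indicator function of a compact convex set \<open>C\<close>, so the dual step is a projection onto \<open>C\<close>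
  (\<open>prox_conjugate_homogeneous\<close>), while the primal step is an implicit gradient step
  (\<open>prox_quadratic\<close>).

  A saddle point \<open>(xs, ys)\<close> exists by Brouwer's fixed-point theorem (\<open>saddle_point_exists\<close>), and
  \<open>xs\<close> minimizes the objective because \<open>F\<close> is the support function of \<open>C\<close> with explicit maximizers
  (\<open>mixed_norm_attained\<close>, \<open>saddle_point_minimizes\<close>).

  Convergence (\<open>accelerated_primal_dual_converges\<close>) follows from a nonincreasing energy that, up to
  the positive constant \<open>1 - \<delta>0 * \<nu>0 * (onorm discrete_grad)\<^sup>2\<close>, dominates
  \<open>\<nu> t / \<delta> t * (norm (x t - xs))\<^sup>2\<close>. The product \<open>\<delta> t * \<nu> t\<close> is constant and \<open>\<delta> t\<close> tends to zero, so
  the distance from \<open>x t\<close> to \<open>xs\<close> is of order \<open>\<delta> t\<close>.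
\<close>

section \<open>Accelerated primal-dual iterations\<close>

text \<open>The acceleration keeps \<open>\<tau> t * \<sigma> t\<close> constant while \<open>\<tau>\<close> tends to zero.\<close>

lemma accelerated_step_sizes:
  fixes \<mu> :: real and \<tau> \<sigma> \<theta> :: "nat \<Rightarrow> real"
  assumes \<mu>: "\<mu> > 0" and init: "\<tau> 0 > 0" "\<sigma> 0 > 0"
    and \<theta>: "\<And>t. \<theta> t = (1 + 2 * \<mu> * \<tau> t) powr (- 1 / 2)"
    and \<tau>: "\<And>t. \<tau> (Suc t) = \<theta> t * \<tau> t"
    and \<sigma>: "\<And>t. \<sigma> (Suc t) = \<sigma> t / \<theta> t"
  shows "\<tau> t > 0" "\<sigma> t > 0" "0 < \<theta> t" "\<theta> t < 1" "(\<theta> t)\<^sup>2 * (1 + 2 * \<mu> * \<tau> t) = 1"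
    "\<tau> t * \<sigma> t = \<tau> 0 * \<sigma> 0" "\<tau> \<longlonglongrightarrow> 0"
proof -
  have \<tau>_pos: "\<tau> t > 0" for t
  proof (induction t)
    case (Suc t)
    have "1 + 2 * \<mu> * \<tau> t > 0" using \<mu> Suc by (simp add: add_pos_pos)
    then show ?case using Suc by (simp add: \<tau> \<theta>)
  qed (use init in simp)
  have gt1: "1 + 2 * \<mu> * \<tau> t > 1" for t
    using \<mu> \<tau>_pos[of t] by simp
  have \<theta>_pos: "\<theta> t > 0" for t
    using gt1[of t] by (simp add: \<theta>)
  have \<theta>_sq: "(\<theta> t)\<^sup>2 * (1 + 2 * \<mu> * \<tau> t) = 1" for t
  proof -
    have "(\<theta> t)\<^sup>2 = (1 + 2 * \<mu> * \<tau> t) powr (- 1)"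
      by (simp add: \<theta> power2_eq_square powr_add[symmetric])
    also have "\<dots> = 1 / (1 + 2 * \<mu> * \<tau> t)"
      using gt1[of t] by (simp add: powr_minus_divide)
    finally show ?thesis using gt1[of t] by simp
  qed
  have \<theta>_less: "\<theta> t < 1" for t
  proof (rule ccontr)
    assume "\<not> \<theta> t < 1"
    then have "1 \<le> (\<theta> t)\<^sup>2" by simp
    then have "1 * (1 + 2 * \<mu> * \<tau> t) \<le> (\<theta> t)\<^sup>2 * (1 + 2 * \<mu> * \<tau> t)"
      using gt1[of t] by (intro mult_right_mono) auto
    then show False using \<theta>_sq[of t] gt1[of t] by simp
  qed
  have \<sigma>_pos: "\<sigma> t > 0" for t
    by (induction t) (use init \<theta>_pos in \<open>auto simp: \<sigma>\<close>)
  have prod: "\<tau> t * \<sigma> t = \<tau> 0 * \<sigma> 0" for t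
  proof (induction t)
    case (Suc t)
    then show ?case using \<theta>_pos[of t] by (simp add: \<tau> \<sigma>)
  qed simp
  \<comment> \<open>A decreasing positive sequence has a limit; passing to it in the squared recursion forces the
     limit to vanish.\<close>
  have "decseq \<tau>"
    using \<theta>_less \<tau>_pos by (intro decseq_SucI) (simp add: \<tau> mult_le_cancel_right1 less_imp_le)
  then obtain T where T: "\<tau> \<longlonglongrightarrow> T"
    using decseq_convergent[of \<tau> 0] \<tau>_pos less_imp_le by metis
  have T_nonneg: "T \<ge> 0"
    by (rule LIMSEQ_le_const[OF T]) (use \<tau>_pos in \<open>auto intro: less_imp_le\<close>)
  have "(\<lambda>t. (\<tau> (Suc t))\<^sup>2 * (1 + 2 * \<mu> * \<tau> t)) \<longlonglongrightarrow> T\<^sup>2 * (1 + 2 * \<mu> * T)"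
    by (intro tendsto_intros T LIMSEQ_Suc)
  moreover have "(\<tau> (Suc t))\<^sup>2 * (1 + 2 * \<mu> * \<tau> t) = (\<tau> t)\<^sup>2" for t
  proof -
    have "(\<tau> (Suc t))\<^sup>2 * (1 + 2 * \<mu> * \<tau> t) = ((\<theta> t)\<^sup>2 * (1 + 2 * \<mu> * \<tau> t)) * (\<tau> t)\<^sup>2"
      by (simp add: \<tau> power_mult_distrib mult_ac)
    then show ?thesis by (simp add: \<theta>_sq)
  qed
  ultimately have "(\<lambda>t. (\<tau> t)\<^sup>2) \<longlonglongrightarrow> T\<^sup>2 * (1 + 2 * \<mu> * T)" by simp
  moreover have "(\<lambda>t. (\<tau> t)\<^sup>2) \<longlonglongrightarrow> T\<^sup>2" by (intro tendsto_intros T)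
  ultimately have "T\<^sup>2 * (1 + 2 * \<mu> * T) = T\<^sup>2" by (rule LIMSEQ_unique)
  then have "T\<^sup>2 * (2 * \<mu> * T) = 0" by (simp add: algebra_simps)
  then have "T = 0" using \<mu> by auto
  with T show "\<tau> \<longlonglongrightarrow> 0" by simp
  show "\<tau> t > 0" "\<sigma> t > 0" "0 < \<theta> t" "\<theta> t < 1" "(\<theta> t)\<^sup>2 * (1 + 2 * \<mu> * \<tau> t) = 1"
    "\<tau> t * \<sigma> t = \<tau> 0 * \<sigma> 0"
    using \<tau>_pos \<sigma>_pos \<theta>_pos \<theta>_less \<theta>_sq prod by blast+
qed

text \<open>
  The bilinear coupling is dominated by the primal and dual distances, in the weights in which they
  enter the energy; the factor \<open>\<tau> * \<sigma> * k\<^sup>2\<close> is the quantity that the step-size condition keeps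
  below one.
\<close>

lemma coupling_bound:
  fixes K :: "'a::real_inner \<Rightarrow> 'b::real_inner"
  assumes K: "norm (K d) \<le> k * norm d" and pos: "\<tau> > 0" "\<sigma> > 0"
  shows "\<bar>2 * \<sigma> * (K d \<bullet> g)\<bar> \<le> (\<tau> * \<sigma> * k\<^sup>2) * (\<sigma> / \<tau> * (norm d)\<^sup>2) + (norm g)\<^sup>2"
proof -
  have "\<bar>2 * \<sigma> * (K d \<bullet> g)\<bar> = 2 * \<sigma> * \<bar>K d \<bullet> g\<bar>"
    using pos by (simp add: abs_mult)
  also have "\<dots> \<le> 2 * \<sigma> * (norm (K d) * norm g)"
    using pos by (intro mult_left_mono Cauchy_Schwarz_ineq2) auto
  also have "\<dots> \<le> 2 * \<sigma> * (k * norm d * norm g)"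
    using pos K by (intro mult_left_mono mult_right_mono) auto
  also have "\<dots> = 2 * (\<sigma> * k * norm d) * norm g" by simp
  also have "\<dots> \<le> (\<sigma> * k * norm d)\<^sup>2 + (norm g)\<^sup>2"
    by (rule sum_squares_bound)
  also have "(\<sigma> * k * norm d)\<^sup>2 = (\<tau> * \<sigma> * k\<^sup>2) * (\<sigma> / \<tau> * (norm d)\<^sup>2)"
    using pos by (simp add: power2_eq_square)
  finally show ?thesis .
qed

text \<open>
  One iteration \<open>(x, y) \<mapsto> (x', y')\<close>, measured against a saddle point \<open>(xs, ys)\<close>, which is expressed by
  stationarity in \<open>x\<close> and a variational inequality over \<open>C\<close> in \<open>y\<close>. The primal step is
  the resolvent of the strongly monotone operator \<open>A\<close> (in the application, the gradient of the data
  fidelity), tested against \<open>x' - xs\<close>; the dual step is a projection onto \<open>C\<close>, tested against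
  \<open>ys\<close>. The dual inequality has weight \<open>1\<close> and the primal one weight \<open>\<sigma> / \<tau>\<close>, so that the
  coupling terms have the same factor.
\<close>

lemma primal_dual_step:
  fixes A :: "'a::real_inner \<Rightarrow> 'a" and K :: "'a \<Rightarrow> 'b::real_inner"
  assumes lin: "linear K"
    and mono: "\<And>x x'. \<mu> * (norm (x - x'))\<^sup>2 \<le> (A x - A x') \<bullet> (x - x')"
    and pos: "\<tau> > 0" "\<sigma> > 0"
    and saddle: "\<And>d. A xs \<bullet> d + K d \<bullet> ys = 0" "ys \<in> C" "\<And>z. z \<in> C \<Longrightarrow> K xs \<bullet> (z - ys) \<le> 0"
    and primal: "\<And>d. (x - x') \<bullet> d = \<tau> * (A x' \<bullet> d + K d \<bullet> yb)"
    and dual: "y' \<in> C" "\<And>z. z \<in> C \<Longrightarrow> (y + \<sigma> *\<^sub>R K x' - y') \<bullet> (z - y') \<le> 0"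
  shows "\<sigma> / \<tau> * (1 + 2 * \<mu> * \<tau>) * (norm (x' - xs))\<^sup>2 + (norm (y' - ys))\<^sup>2
      + \<sigma> / \<tau> * (norm (x - x'))\<^sup>2 + (norm (y' - y))\<^sup>2
      + 2 * \<sigma> * (K (x' - xs) \<bullet> (yb - y'))
    \<le> \<sigma> / \<tau> * (norm (x - xs))\<^sup>2 + (norm (y - ys))\<^sup>2"
proof -
  interpret K: linear K by (rule lin)
  have "\<mu> * (norm (x' - xs))\<^sup>2 \<le> A x' \<bullet> (x' - xs) + K (x' - xs) \<bullet> ys"
    using mono[of x' xs] saddle(1)[of "x' - xs"] by (simp add: inner_diff_left)
  then have "\<tau> * (\<mu> * (norm (x' - xs))\<^sup>2 + K (x' - xs) \<bullet> (yb - ys)) \<le> (x - x') \<bullet> (x' - xs)"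
    unfolding primal using pos by (intro mult_left_mono) (auto simp: inner_diff_right)
  moreover have "2 * ((x - x') \<bullet> (x' - xs)) =
      (norm (x - xs))\<^sup>2 - (norm (x' - xs))\<^sup>2 - (norm (x - x'))\<^sup>2"
    by (simp add: power2_norm_eq_inner inner_diff_left inner_diff_right inner_commute)
  ultimately have P: "(1 + 2 * \<mu> * \<tau>) * (norm (x' - xs))\<^sup>2 + (norm (x - x'))\<^sup>2
      + 2 * \<tau> * (K (x' - xs) \<bullet> (yb - ys)) \<le> (norm (x - xs))\<^sup>2"
    by (simp add: algebra_simps)
  have "\<sigma> / \<tau> * ((1 + 2 * \<mu> * \<tau>) * (norm (x' - xs))\<^sup>2 + (norm (x - x'))\<^sup>2
      + 2 * \<tau> * (K (x' - xs) \<bullet> (yb - ys))) \<le> \<sigma> / \<tau> * (norm (x - xs))\<^sup>2"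
    using pos P by (intro mult_left_mono) auto
  then have P': "\<sigma> / \<tau> * (1 + 2 * \<mu> * \<tau>) * (norm (x' - xs))\<^sup>2 + \<sigma> / \<tau> * (norm (x - x'))\<^sup>2
      + 2 * \<sigma> * (K (x' - xs) \<bullet> (yb - ys)) \<le> \<sigma> / \<tau> * (norm (x - xs))\<^sup>2"
    using pos by (simp add: ring_distribs mult.assoc)
  have "\<sigma> * (K xs \<bullet> (y' - ys)) \<le> 0"
    using saddle(3)[OF dual(1)] pos by (simp add: mult_le_0_iff)
  moreover have "2 * ((y + \<sigma> *\<^sub>R K x' - y') \<bullet> (ys - y')) = 
      (norm (y' - ys))\<^sup>2 + (norm (y' - y))\<^sup>2 - (norm (y - ys))\<^sup>2 - 2 * \<sigma> * (K x' \<bullet> (y' - ys))"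
    by (simp add: power2_norm_eq_inner inner_diff_left inner_diff_right inner_add_left
        inner_commute algebra_simps)
  ultimately have D: "(norm (y' - ys))\<^sup>2 + (norm (y' - y))\<^sup>2 - 2 * \<sigma> * (K (x' - xs) \<bullet> (y' - ys))
      \<le> (norm (y - ys))\<^sup>2"
    using dual(2)[OF saddle(2)] by (simp add: K.diff inner_diff_left algebra_simps)
  have "2 * \<sigma> * (K (x' - xs) \<bullet> (yb - y')) =
      2 * \<sigma> * (K (x' - xs) \<bullet> (yb - ys)) - 2 * \<sigma> * (K (x' - xs) \<bullet> (y' - ys))"
    by (simp add: inner_diff_right algebra_simps)
  with P' D show ?thesis by linarith
qed

text \<open>
  The energy \<open>V\<close> below does not increase along the iteration, because the strong monotonicity factor
  \<open>1 + 2 * \<mu> * \<tau> t\<close> is exactly what turns the weight \<open>\<sigma> t / \<tau> t\<close> into \<open>\<sigma> (Suc t) / \<tau> (Suc t)\<close>.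
  That weight equals \<open>\<tau> 0 * \<sigma> 0 / (\<tau> t)\<^sup>2\<close>, so bounded energy means that the distance to the saddle
  point is of order \<open>\<tau> t\<close>.
\<close>

theorem accelerated_primal_dual_converges:
  fixes A :: "'a::real_inner \<Rightarrow> 'a" and K :: "'a \<Rightarrow> 'b::real_inner"
    and x :: "nat \<Rightarrow> 'a" and y yb :: "nat \<Rightarrow> 'b"
  assumes lin: "linear K" and K: "\<And>d. norm (K d) \<le> k * norm d"
    and mono: "\<And>x x'. \<mu> * (norm (x - x'))\<^sup>2 \<le> (A x - A x') \<bullet> (x - x')"
    and \<mu>: "\<mu> > 0" and init: "\<tau> 0 > 0" "\<sigma> 0 > 0" and small: "\<tau> 0 * \<sigma> 0 * k\<^sup>2 < 1"
    and \<theta>: "\<And>t. \<theta> t = (1 + 2 * \<mu> * \<tau> t) powr (- 1 / 2)"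
    and \<tau>: "\<And>t. \<tau> (Suc t) = \<theta> t * \<tau> t"
    and \<sigma>: "\<And>t. \<sigma> (Suc t) = \<sigma> t / \<theta> t"
    and saddle: "\<And>d. A xs \<bullet> d + K d \<bullet> ys = 0" "ys \<in> C" "\<And>z. z \<in> C \<Longrightarrow> K xs \<bullet> (z - ys) \<le> 0"
    and primal: "\<And>t d. (x t - x (Suc t)) \<bullet> d = \<tau> t * (A (x (Suc t)) \<bullet> d + K d \<bullet> yb t)"
    and dual: "\<And>t. y (Suc t) \<in> C"
      "\<And>t z. z \<in> C \<Longrightarrow> (y t + \<sigma> t *\<^sub>R K (x (Suc t)) - y (Suc t)) \<bullet> (z - y (Suc t)) \<le> 0"
    and yb: "yb 0 = y 0" "\<And>t. yb (Suc t) = y (Suc t) + \<theta> t *\<^sub>R (y (Suc t) - y t)"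
  shows "x \<longlonglongrightarrow> xs"
proof -
  interpret K: linear K by (rule lin)
  note step = accelerated_step_sizes[where \<mu> = \<mu> and \<tau> = \<tau> and \<sigma> = \<sigma> and \<theta> = \<theta>, OF \<mu> init \<theta> \<tau> \<sigma>]
  define c where "c = \<tau> 0 * \<sigma> 0 * k\<^sup>2"
  \<comment> \<open>\<open>g t\<close> is the extrapolation \<open>\<theta> (t - 1) * (y t - y (t - 1))\<close>, and zero for \<open>t = 0\<close>.\<close>
  define g where "g t = yb t - y t" for t
  define V where "V t = \<sigma> t / \<tau> t * (norm (x t - xs))\<^sup>2 + (norm (y t - ys))\<^sup>2
    + (norm (g t))\<^sup>2 - 2 * \<sigma> t * (K (x t - xs) \<bullet> g t)" for t
  have couple: "\<bar>2 * \<sigma> t * (K d \<bullet> e)\<bar> \<le> c * (\<sigma> t / \<tau> t * (norm d)\<^sup>2) + (norm e)\<^sup>2" for t d e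
    using coupling_bound[where K = K and k = k and d = d and g = e, OF K step(1)[of t] step(2)[of t]]
    unfolding c_def step(6)[of t] .
  have descent: "V (Suc t) \<le> V t" for t
  proof -
    let ?q = "y (Suc t) - y t" and ?a = "x (Suc t) - xs" and ?d = "x t - x (Suc t)"
    have \<theta>t: "0 < \<theta> t" "\<theta> t < 1" using step by blast+
    have g_Suc: "g (Suc t) = \<theta> t *\<^sub>R ?q" by (simp add: g_def yb)
    have weight: "\<sigma> t / \<tau> t * (1 + 2 * \<mu> * \<tau> t) = \<sigma> (Suc t) / \<tau> (Suc t)"
    proof -
      have "1 + 2 * \<mu> * \<tau> t = 1 / (\<theta> t)\<^sup>2"
        using step(5)[of t] \<theta>t by (simp add: field_simps)
      then show ?thesis by (simp add: \<tau> \<sigma> power2_eq_square)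
    qed
    \<comment> \<open>The extrapolation makes the coupling terms of consecutive iterations telescope.\<close>
    have cross: "2 * \<sigma> (Suc t) * (K ?a \<bullet> g (Suc t)) = 2 * \<sigma> t * (K ?a \<bullet> ?q)"
      using \<theta>t by (simp add: g_Suc \<sigma>)
    have g_le: "(norm (g (Suc t)))\<^sup>2 \<le> (norm ?q)\<^sup>2"
      using \<theta>t by (auto simp: g_Suc intro!: power_mono mult_left_le_one_le)
    have "\<sigma> (Suc t) / \<tau> (Suc t) * (norm ?a)\<^sup>2 + (norm (y (Suc t) - ys))\<^sup>2
        + \<sigma> t / \<tau> t * (norm ?d)\<^sup>2 + (norm ?q)\<^sup>2 + 2 * \<sigma> t * (K ?a \<bullet> (yb t - y (Suc t)))
      \<le> \<sigma> t / \<tau> t * (norm (x t - xs))\<^sup>2 + (norm (y t - ys))\<^sup>2"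
      using primal_dual_step[OF lin mono step(1)[of t] step(2)[of t] saddle primal[of t] dual(1)[of t]
          dual(2)] unfolding weight by simp
    moreover have "2 * \<sigma> t * (K ?a \<bullet> (yb t - y (Suc t))) =
        2 * \<sigma> t * (K (x t - xs) \<bullet> g t) - 2 * \<sigma> t * (K ?d \<bullet> g t) - 2 * \<sigma> t * (K ?a \<bullet> ?q)"
      by (simp add: g_def K.diff inner_diff_left inner_diff_right algebra_simps)
    moreover have "2 * \<sigma> t * (K ?d \<bullet> g t) \<le> \<sigma> t / \<tau> t * (norm ?d)\<^sup>2 + (norm (g t))\<^sup>2"
    proof -
      have "2 * \<sigma> t * (K ?d \<bullet> g t) \<le> c * (\<sigma> t / \<tau> t * (norm ?d)\<^sup>2) + (norm (g t))\<^sup>2"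
        using couple[of t ?d "g t"] by linarith
      also have "c * (\<sigma> t / \<tau> t * (norm ?d)\<^sup>2) \<le> 1 * (\<sigma> t / \<tau> t * (norm ?d)\<^sup>2)"
        using small step(1)[of t] step(2)[of t] unfolding c_def
        by (intro mult_right_mono) (auto intro: less_imp_le)
      finally show ?thesis by simp
    qed
    ultimately show ?thesis
      using cross g_le unfolding V_def by linarith
  qed
  have V_le: "V t \<le> V 0" for t
  proof (induction t)
    case (Suc t)
    then show ?case using descent[of t] by linarith
  qed simp
  have bound: "(norm (x t - xs))\<^sup>2 \<le> V 0 / ((1 - c) * (\<tau> 0 * \<sigma> 0)) * (\<tau> t)\<^sup>2" for t
  proof -
    have "2 * \<sigma> t * (K (x t - xs) \<bullet> g t)
        \<le> c * (\<sigma> t / \<tau> t * (norm (x t - xs))\<^sup>2) + (norm (g t))\<^sup>2"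
      using couple[of t "x t - xs" "g t"] by linarith
    moreover have "0 \<le> (norm (y t - ys))\<^sup>2" by simp
    ultimately have "(1 - c) * (\<sigma> t / \<tau> t * (norm (x t - xs))\<^sup>2) \<le> V t"
      unfolding V_def left_diff_distrib by linarith
    then have "(1 - c) * (\<sigma> t / \<tau> t * (norm (x t - xs))\<^sup>2) \<le> V 0"
      using V_le[of t] by linarith
    moreover have "\<sigma> t / \<tau> t = \<tau> 0 * \<sigma> 0 / (\<tau> t)\<^sup>2"
      using step(1)[of t] by (simp add: step(6)[of t, symmetric] power2_eq_square)
    ultimately have "((1 - c) * (\<tau> 0 * \<sigma> 0)) * (norm (x t - xs))\<^sup>2 / (\<tau> t)\<^sup>2 \<le> V 0"
      by (simp add: mult.assoc)
    moreover have "(1 - c) * (\<tau> 0 * \<sigma> 0) > 0"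
      using small init by (simp add: c_def)
    ultimately show ?thesis
      using step(1)[of t] by (simp add: divide_le_eq le_divide_eq mult_ac)
  qed
  have "(\<lambda>t. V 0 / ((1 - c) * (\<tau> 0 * \<sigma> 0)) * (\<tau> t)\<^sup>2) \<longlonglongrightarrow> V 0 / ((1 - c) * (\<tau> 0 * \<sigma> 0)) * 0\<^sup>2"
    by (intro tendsto_intros step(7))
  then have "(\<lambda>t. V 0 / ((1 - c) * (\<tau> 0 * \<sigma> 0)) * (\<tau> t)\<^sup>2) \<longlonglongrightarrow> 0" by simp
  then have "(\<lambda>t. (norm (x t - xs))\<^sup>2) \<longlonglongrightarrow> 0"
    by (rule tendsto_sandwich[rotated 2, OF tendsto_const]) (use bound in auto)
  then have "(\<lambda>t. norm (x t - xs)) \<longlonglongrightarrow> 0"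
    using tendsto_real_sqrt by fastforce
  then show ?thesis
    using LIM_zero_iff tendsto_norm_zero_iff by blast
qed

section \<open>Proximal maps\<close>

lemma arg_min_eqI:
  fixes f :: "'a \<Rightarrow> 'b::order"
  assumes "\<And>y. y \<noteq> x \<Longrightarrow> f x < f y"
  shows "arg_min f (\<lambda>_. True) = x"
  unfolding arg_min_def is_arg_min_def
  by (rule some_equality) (metis assms less_asym)+

lemma linear_surjective_if_positive:
  fixes M :: "'a::euclidean_space \<Rightarrow> 'a"
  assumes lin: "linear M" and pos: "\<And>d. d \<noteq> 0 \<Longrightarrow> 0 < M d \<bullet> d"
  shows "inj M" "surj M"
proof -
  interpret M: linear M by (rule lin)
  show "inj M"
  proof (rule injI)
    fix x y assume "M x = M y"
    then have "M (x - y) \<bullet> (x - y) = 0" by (simp add: M.diff)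
    then show "x = y" using pos[of "x - y"] by auto
  qed
  then show "surj M" using linear_injective_imp_surjective[OF lin] by simp
qed

text \<open>
  The proximal map of a convex quadratic \<open>\<Phi>\<close> with gradient \<open>M x - b\<close> is an implicit gradient step.
\<close>

lemma prox_quadratic:
  fixes M :: "'a::euclidean_space \<Rightarrow> 'a"
  assumes lin: "linear M" and pos: "\<And>d. 0 \<le> M d \<bullet> d" and \<gamma>: "\<gamma> > 0"
    and expand: "\<And>x d. \<Phi> (x + d) = \<Phi> x + (M x - b) \<bullet> d + 1 / 2 * (M d \<bullet> d)"
  shows "x - prox \<gamma> (\<lambda>y. ereal (\<Phi> y)) x = \<gamma> *\<^sub>R (M (prox \<gamma> (\<lambda>y. ereal (\<Phi> y)) x) - b)"
proof -
  have lin': "linear (\<lambda>d. d + \<gamma> *\<^sub>R M d)"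
    by (intro linear_compose_add linear_compose_scale_right linear_id[unfolded id_def] lin)
  have pos': "0 < (d + \<gamma> *\<^sub>R M d) \<bullet> d" if "d \<noteq> 0" for d
    using that pos[of d] \<gamma> by (simp add: inner_add_left add_pos_nonneg)
  have "surj (\<lambda>d. d + \<gamma> *\<^sub>R M d)"
    using lin' pos' by (rule linear_surjective_if_positive(2))
  then obtain y where "x + \<gamma> *\<^sub>R b = y + \<gamma> *\<^sub>R M y"
    by (rule surjE)
  then have y: "x - y = \<gamma> *\<^sub>R (M y - b)" by (simp add: algebra_simps)
  have "prox \<gamma> (\<lambda>y. ereal (\<Phi> y)) x = y"
    unfolding prox_def
  proof (rule arg_min_eqI)
    fix z assume "z \<noteq> y"
    define d where "d = z - y"
    have d: "z = y + d" "d \<noteq> 0" using \<open>z \<noteq> y\<close> by (auto simp: d_def)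
    have "(norm (x - z))\<^sup>2 = (norm (x - y))\<^sup>2 - 2 * ((x - y) \<bullet> d) + (norm d)\<^sup>2"
      by (simp add: d power2_norm_eq_inner inner_diff_left inner_diff_right inner_add_left
          inner_add_right inner_commute)
    then have "1 / 2 * (norm (x - z))\<^sup>2 + \<gamma> * \<Phi> z =
        1 / 2 * (norm (x - y))\<^sup>2 + \<gamma> * \<Phi> y + 1 / 2 * ((norm d)\<^sup>2 + \<gamma> * (M d \<bullet> d))"
      unfolding y d(1) expand by (simp add: algebra_simps)
    moreover have "0 < 1 / 2 * ((norm d)\<^sup>2 + \<gamma> * (M d \<bullet> d))"
      using d(2) pos[of d] \<gamma> by (simp add: add_pos_nonneg)
    ultimately have "1 / 2 * (norm (x - y))\<^sup>2 + \<gamma> * \<Phi> y < 1 / 2 * (norm (x - z))\<^sup>2 + \<gamma> * \<Phi> z"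
      by (metis less_add_same_cancel1)
    then show "ereal (1 / 2 * (norm (x - y))\<^sup>2) + ereal \<gamma> * ereal (\<Phi> y)
        < ereal (1 / 2 * (norm (x - z))\<^sup>2) + ereal \<gamma> * ereal (\<Phi> z)"
      by simp
  qed
  with y show ?thesis by simp
qed

text \<open>
  When \<open>F\<close> is a norm, this is the unit ball of the dual norm; for a seminorm it lies in the
  annihilator of the kernel of \<open>F\<close>.
\<close>

definition dual_ball :: "('a::real_inner \<Rightarrow> real) \<Rightarrow> 'a set" where
  "dual_ball F = {y. \<forall>z. z \<bullet> y \<le> F z}"

lemma closed_dual_ball: "closed (dual_ball F)"
proof -
  have "dual_ball F = (\<Inter>z. {y. z \<bullet> y \<le> F z})" by (auto simp: dual_ball_def)
  then show ?thesis by (auto intro: closed_halfspace_le)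
qed

lemma convex_dual_ball: "convex (dual_ball F)"
proof -
  have "dual_ball F = (\<Inter>z. {y. z \<bullet> y \<le> F z})" by (auto simp: dual_ball_def)
  then show ?thesis by (auto intro: convex_INT convex_halfspace_le)
qed

lemma zero_in_dual_ball: "(\<And>z. 0 \<le> F z) \<Longrightarrow> 0 \<in> dual_ball F"
  by (simp add: dual_ball_def)

lemma bounded_dual_ball:
  fixes F :: "'a::euclidean_space \<Rightarrow> real"
  assumes "continuous_on UNIV F"
  shows "bounded (dual_ball F)"
proof -
  have "compact (F ` sphere 0 1)"
    by (intro compact_continuous_image continuous_on_subset[OF assms] compact_sphere subset_UNIV)
  then have "bounded (F ` sphere 0 1)" by (rule compact_imp_bounded)
  then obtain B where "\<forall>w\<in>F ` sphere 0 1. \<bar>w\<bar> \<le> B"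
    unfolding bounded_real by blast
  then have B: "F z \<le> B" if "norm z = 1" for z
    using that by (force simp: abs_le_iff)
  have "norm y \<le> max B 0" if "y \<in> dual_ball F" for y
  proof (cases "y = 0")
    case False
    have "norm y = sgn y \<bullet> y"
      using False by (simp add: sgn_div_norm power2_norm_eq_inner[symmetric] power2_eq_square)
    also have "\<dots> \<le> F (sgn y)" using that by (simp add: dual_ball_def)
    also have "\<dots> \<le> B" using B False by (simp add: norm_sgn)
    finally show ?thesis by simp
  qed simp
  then show ?thesis by (auto simp: bounded_iff)
qed

text \<open>
  The conjugate of a positively homogeneous function is the indicator function of its dual ball. If
  the function is also nonnegative, the ball is nonempty and the proximal map of the conjugate is the
  projection onto it.
\<close>

lemma fenchel_conjugate_homogeneous:
  assumes hom: "\<And>c z. c \<ge> 0 \<Longrightarrow> F (c *\<^sub>R z) = c * F z"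
  shows "fenchel_conjugate (\<lambda>z. ereal (F z)) y = (if y \<in> dual_ball F then 0 else \<infinity>)"
proof (cases "y \<in> dual_ball F")
  case True
  have "F 0 = 0" using hom[of 0 0] by simp
  have "(SUP z. ereal (z \<bullet> y) - ereal (F z)) = 0"
  proof (rule antisym)
    show "(SUP z. ereal (z \<bullet> y) - ereal (F z)) \<le> 0"
      using True by (intro SUP_least) (simp add: dual_ball_def)
    show "0 \<le> (SUP z. ereal (z \<bullet> y) - ereal (F z))"
      by (rule SUP_upper2[of 0]) (simp_all add: \<open>F 0 = 0\<close>)
  qed
  with True show ?thesis by (simp add: fenchel_conjugate_def)
next
  case False
  then obtain z where z: "F z < z \<bullet> y" by (auto simp: dual_ball_def not_le)
  have "(SUP z. ereal (z \<bullet> y) - ereal (F z)) = \<infinity>"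
  proof (rule ereal_top)
    fix B
    \<comment> \<open>Scaling a vector that violates the constraint makes the supremum exceed any bound.\<close>
    define c where "c = max B 0 / (z \<bullet> y - F z)"
    have "c \<ge> 0" using z by (simp add: c_def)
    have "c * (z \<bullet> y - F z) = max B 0" using z by (simp add: c_def)
    then have "B \<le> (c *\<^sub>R z) \<bullet> y - F (c *\<^sub>R z)"
      using hom[OF \<open>c \<ge> 0\<close>] by (simp add: algebra_simps)
    then show "ereal B \<le> (SUP z. ereal (z \<bullet> y) - ereal (F z))"
      by (intro SUP_upper2[of "c *\<^sub>R z"]) auto
  qed
  with False show ?thesis by (simp add: fenchel_conjugate_def)
qed

lemma prox_conjugate_homogeneous:
  fixes F :: "'a::euclidean_space \<Rightarrow> real"
  assumes hom: "\<And>c z. c \<ge> 0 \<Longrightarrow> F (c *\<^sub>R z) = c * F z" and nonneg: "\<And>z. 0 \<le> F z" and \<gamma>: "\<gamma> > 0"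
  shows "prox \<gamma> (fenchel_conjugate (\<lambda>z. ereal (F z))) x = closest_point (dual_ball F) x"
  unfolding prox_def
proof (rule arg_min_eqI)
  let ?C = "dual_ball F" and ?p = "closest_point (dual_ball F) x"
  have conj: "fenchel_conjugate (\<lambda>z. ereal (F z)) y = (if y \<in> ?C then 0 else \<infinity>)" for y
    using hom by (rule fenchel_conjugate_homogeneous)
  have "0 \<in> ?C" using nonneg by (rule zero_in_dual_ball)
  then have ne: "?C \<noteq> {}" by blast
  have p: "?p \<in> ?C" by (rule closest_point_in_set[OF closed_dual_ball ne])
  fix z assume "z \<noteq> ?p"
  show "ereal (1 / 2 * (norm (x - ?p))\<^sup>2) + ereal \<gamma> * fenchel_conjugate (\<lambda>z. ereal (F z)) ?p
      < ereal (1 / 2 * (norm (x - z))\<^sup>2) + ereal \<gamma> * fenchel_conjugate (\<lambda>z. ereal (F z)) z"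
  proof (cases "z \<in> ?C")
    case True
    have "dist x ?p < dist x z"
      by (rule closest_point_lt[OF convex_dual_ball closed_dual_ball True \<open>z \<noteq> ?p\<close>])
    then show ?thesis
      using True p by (simp add: conj dist_norm power_strict_mono)
  next
    case False
    then show ?thesis
      using p \<gamma> by (simp add: conj)
  qed
qed

section \<open>Existence of a saddle point\<close>

text \<open>
  For a dual variable \<open>y\<close>, let \<open>X y\<close> be the point where the gradient \<open>M x - b\<close> cancels the adjoint
  of \<open>K\<close> at \<open>y\<close>. It depends continuously on \<open>y\<close>, so one dual projection step started from
  \<open>(X y, y)\<close> is a continuous self-map of the compact convex set \<open>C\<close>. A fixed point, which exists by
  Brouwer's theorem, is a saddle point.
\<close>

lemma saddle_point_exists:
  fixes M :: "'a::euclidean_space \<Rightarrow> 'a" and K :: "'a \<Rightarrow> 'b::euclidean_space"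
  assumes linM: "linear M" and pos: "\<And>d. d \<noteq> 0 \<Longrightarrow> 0 < M d \<bullet> d" and linK: "linear K"
    and C: "compact C" "convex C" "C \<noteq> {}"
  obtains xs ys where "\<And>d. (M xs - b) \<bullet> d + K d \<bullet> ys = 0" "ys \<in> C"
    "\<And>z. z \<in> C \<Longrightarrow> K xs \<bullet> (z - ys) \<le> 0"
proof -
  obtain W where W: "linear W" "\<And>x. M (W x) = x"
    using linear_surjective_right_inverse[OF linM linear_surjective_if_positive(2)[OF linM pos]]
    by (metis comp_apply id_apply)
  define X where "X y = W (b - adjoint K y)" for y
  have "closed C" using C by (simp add: compact_imp_closed)
  have contX: "continuous_on C (\<lambda>y. K (X y))"
    unfolding X_def
    by (intro linear_continuous_on_compose[OF _ linK] linear_continuous_on_compose[OF _ W(1)]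
        continuous_intros linear_continuous_on adjoint_linear[OF linK]
        linear_conv_bounded_linear[THEN iffD1])
  have "continuous_on C (closest_point C \<circ> (\<lambda>y. y + K (X y)))"
    by (intro continuous_on_compose continuous_intros contX
        continuous_on_closest_point[OF C(2) \<open>closed C\<close> C(3)])
  then obtain ys where ys: "ys \<in> C" "closest_point C (ys + K (X ys)) = ys"
    using brouwer[OF C, of "closest_point C \<circ> (\<lambda>y. y + K (X y))"]
      closest_point_in_set[OF \<open>closed C\<close> C(3)] by auto
  have "(M (X ys) - b) \<bullet> d + K d \<bullet> ys = 0" for d
    using adjoint_works[OF linK, of d ys] by (simp add: X_def W inner_commute)
  moreover have "K (X ys) \<bullet> (z - ys) \<le> 0" if "z \<in> C" for z
    using closest_point_dot[OF C(2) \<open>closed C\<close> that, of "ys + K (X ys)"] ys(2) by simp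
  ultimately show ?thesis using that ys(1) by blast
qed

text \<open>
  Weak duality: if \<open>F\<close> bounds every functional given by a point of \<open>C\<close>, and one of them agrees with
  \<open>F\<close> at \<open>K xs\<close>, then a saddle point minimizes the convex quadratic \<open>\<Phi>\<close> plus \<open>F \<circ> K\<close>.
\<close>

lemma saddle_point_minimizes:
  fixes M :: "'a::real_inner \<Rightarrow> 'a" and K :: "'a \<Rightarrow> 'b::real_inner" and F :: "'b \<Rightarrow> real"
  assumes linK: "linear K" and pos: "\<And>d. 0 \<le> M d \<bullet> d"
    and expand: "\<And>x d. \<Phi> (x + d) = \<Phi> x + (M x - b) \<bullet> d + 1 / 2 * (M d \<bullet> d)"
    and saddle: "\<And>d. (M xs - b) \<bullet> d + K d \<bullet> ys = 0" "ys \<in> C"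
      "\<And>z. z \<in> C \<Longrightarrow> K xs \<bullet> (z - ys) \<le> 0"
    and F: "\<And>w z. z \<in> C \<Longrightarrow> w \<bullet> z \<le> F w" "\<exists>z\<in>C. K xs \<bullet> z = F (K xs)"
  shows "is_arg_min (\<lambda>x. \<Phi> x + F (K x)) (\<lambda>_. True) xs"
  unfolding is_arg_min_linorder
proof (intro conjI allI impI TrueI)
  fix x
  have "\<Phi> xs + (M xs - b) \<bullet> (x - xs) \<le> \<Phi> x"
    using expand[of xs "x - xs"] pos[of "x - xs"] by simp
  moreover have "(M xs - b) \<bullet> (x - xs) = K xs \<bullet> ys - K x \<bullet> ys"
    using saddle(1)[of "x - xs"] by (simp add: linear_diff[OF linK] inner_diff_left)
  moreover have "K x \<bullet> ys \<le> F (K x)" by (rule F(1)[OF saddle(2)])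
  moreover obtain z where "z \<in> C" "K xs \<bullet> z = F (K xs)" using F(2) by blast
  then have "F (K xs) \<le> K xs \<bullet> ys"
    using saddle(3)[of z] by (simp add: inner_diff_right)
  ultimately show "\<Phi> xs + F (K xs) \<le> \<Phi> x + F (K x)" by linarith
qed

section \<open>The discrete gradient and the mixed norm\<close>

lemma linear_discrete_grad: "linear (discrete_grad :: 'n::{finite,linorder} image \<Rightarrow> 'n image ^ 2)"
  by (rule linearI)
    (auto simp: discrete_grad_def vec_eq_iff forall_2 algebra_simps)

text \<open>The Euclidean norm of the vector attached to one pixel of a stack of images.\<close>

definition pixel_norm :: "'n::finite image ^ 'i \<Rightarrow> 'n \<Rightarrow> 'n \<Rightarrow> real" where
  "pixel_norm z n1 n2 = norm (\<chi> i. z $ i $ n1 $ n2)"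

lemma pixel_norm_eq: "pixel_norm z n1 n2 = sqrt (\<Sum>i\<in>UNIV. (z $ i $ n1 $ n2)\<^sup>2)"
  by (simp add: pixel_norm_def norm_vec_def L2_set_def)

lemma mixed_norm_pixel:
  "mixed_norm z = (\<Sum>n1\<in>UNIV - {last_index}. \<Sum>n2\<in>UNIV - {last_index}. pixel_norm z n1 n2)"
  by (simp add: mixed_norm_def pixel_norm_eq)

lemma mixed_norm_nonneg: "0 \<le> mixed_norm z"
  unfolding mixed_norm_pixel by (intro sum_nonneg) (simp add: pixel_norm_def)

lemma mixed_norm_scaleR: "c \<ge> 0 \<Longrightarrow> mixed_norm (c *\<^sub>R z) = c * mixed_norm z"
  by (simp add: mixed_norm_def power_mult_distrib sum_distrib_left[symmetric] real_sqrt_mult)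

lemma continuous_on_mixed_norm: "continuous_on A mixed_norm"
  unfolding mixed_norm_def by (intro continuous_intros)

text \<open>
  The multiple \<open>c * mixed_norm\<close> is the support function of its dual ball, and the maximum is
  attained: at each pixel off the last row and column, \<open>y\<close> is \<open>c\<close> times the direction of \<open>z\<close> (zero
  where \<open>z\<close> vanishes), and elsewhere it is zero.
\<close>

lemma mixed_norm_attained:
  fixes z :: "'n::{finite,linorder} image ^ 'i"
  assumes "c \<ge> 0"
  obtains y where "\<And>z'. z' \<bullet> y \<le> c * mixed_norm z'" "z \<bullet> y = c * mixed_norm z"
proof -
  define y :: "'n image ^ 'i" where
    "y = (\<chi> i n1 n2. if n1 = last_index \<or> n2 = last_index then 0
           else c * sgn (\<chi> i. z $ i $ n1 $ n2) $ i)"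
  have inner_y: "z' \<bullet> y = c * (\<Sum>n1\<in>UNIV - {last_index}. \<Sum>n2\<in>UNIV - {last_index}.
      (\<chi> i. z' $ i $ n1 $ n2) \<bullet> sgn (\<chi> i. z $ i $ n1 $ n2))" for z' :: "'n image ^ 'i"
  proof -
    have "z' \<bullet> y = (\<Sum>i\<in>UNIV. \<Sum>n1\<in>UNIV. \<Sum>n2\<in>UNIV. z' $ i $ n1 $ n2 * y $ i $ n1 $ n2)"
      by (simp add: inner_vec_def)
    also have "\<dots> = (\<Sum>n1\<in>UNIV. \<Sum>n2\<in>UNIV. \<Sum>i\<in>UNIV. z' $ i $ n1 $ n2 * y $ i $ n1 $ n2)"
      by (subst sum.swap) (intro sum.cong refl, rule sum.swap)
    also have "\<dots> = (\<Sum>n1\<in>UNIV - {last_index}. \<Sum>n2\<in>UNIV. \<Sum>i\<in>UNIV.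
        z' $ i $ n1 $ n2 * y $ i $ n1 $ n2)"
      by (intro sum.mono_neutral_right) (auto simp: y_def)
    also have "\<dots> = (\<Sum>n1\<in>UNIV - {last_index}. \<Sum>n2\<in>UNIV - {last_index}. \<Sum>i\<in>UNIV.
        z' $ i $ n1 $ n2 * y $ i $ n1 $ n2)"
      by (intro sum.cong refl sum.mono_neutral_right) (auto simp: y_def)
    also have "\<dots> = (\<Sum>n1\<in>UNIV - {last_index}. \<Sum>n2\<in>UNIV - {last_index}.
        c * ((\<chi> i. z' $ i $ n1 $ n2) \<bullet> sgn (\<chi> i. z $ i $ n1 $ n2)))"
      by (intro sum.cong refl) (auto simp: y_def inner_vec_def sum_distrib_left mult_ac)
    finally show ?thesis by (simp add: sum_distrib_left)
  qed
  have "z' \<bullet> y \<le> c * mixed_norm z'" for z'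
    unfolding inner_y mixed_norm_pixel
  proof (intro mult_left_mono sum_mono assms)
    fix n1 n2
    have "(\<chi> i. z' $ i $ n1 $ n2) \<bullet> sgn (\<chi> i. z $ i $ n1 $ n2)
        \<le> pixel_norm z' n1 n2 * norm (sgn (\<chi> i. z $ i $ n1 $ n2))"
      unfolding pixel_norm_def by (rule norm_cauchy_schwarz)
    also have "\<dots> \<le> pixel_norm z' n1 n2"
      by (simp add: norm_sgn pixel_norm_def)
    finally show "(\<chi> i. z' $ i $ n1 $ n2) \<bullet> sgn (\<chi> i. z $ i $ n1 $ n2) \<le> pixel_norm z' n1 n2" .
  qed
  moreover have "x \<bullet> sgn x = norm x" for x :: "real ^ 'i"
    by (cases "x = 0") (simp_all add: sgn_div_norm power2_norm_eq_inner[symmetric] power2_eq_square)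
  then have "z \<bullet> y = c * mixed_norm z"
    by (simp add: inner_y mixed_norm_pixel pixel_norm_def)
  ultimately show ?thesis using that by blast
qed

section \<open>The data-fidelity term\<close>

text \<open>
  The data fidelity is a quadratic function of the pair \<open>(v, h)\<close> with gradient
  \<open>fidelity_hessian j1 j2 (v, h) - fidelity_offset j1 j2 L\<close>. The Hessian is the \<open>2 \<times> 2\<close> matrix of
  scale moments acting on the two components.
\<close>

definition fidelity_hessian :: "nat \<Rightarrow> nat \<Rightarrow> 'n::finite image \<times> 'n image \<Rightarrow> 'n image \<times> 'n image" where
  "fidelity_hessian j1 j2 = (\<lambda>(v, h).
     (scale_moment j1 j2 0 *\<^sub>R v + scale_moment j1 j2 1 *\<^sub>R h,
      scale_moment j1 j2 1 *\<^sub>R v + scale_moment j1 j2 2 *\<^sub>R h))"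

definition fidelity_offset :: "nat \<Rightarrow> nat \<Rightarrow> (nat \<Rightarrow> 'n::finite image) \<Rightarrow> 'n image \<times> 'n image" where
  "fidelity_offset j1 j2 L =
     (\<Sum>j=j1..j2. log2_image (L j), \<Sum>j=j1..j2. real j *\<^sub>R log2_image (L j))"

lemma linear_fidelity_hessian: "linear (fidelity_hessian j1 j2)"
  by (rule linearI) (auto simp: fidelity_hessian_def algebra_simps)

lemma data_fidelity_expansion:
  "case_prod (data_fidelity j1 j2 L) (x + d) = case_prod (data_fidelity j1 j2 L) x
    + (fidelity_hessian j1 j2 x - fidelity_offset j1 j2 L) \<bullet> d
    + 1 / 2 * (fidelity_hessian j1 j2 d \<bullet> d)"
proof -
  obtain v h where x: "x = (v, h)" by fastforce
  obtain p q where d: "d = (p, q)" by fastforce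
  let ?l = "\<lambda>j. log2_image (L j)"
  have "(norm (v + p + real j *\<^sub>R (h + q) - ?l j))\<^sup>2 = (norm (v + real j *\<^sub>R h - ?l j))\<^sup>2
      + 2 * ((v + real j *\<^sub>R h - ?l j) \<bullet> (p + real j *\<^sub>R q)) + (norm (p + real j *\<^sub>R q))\<^sup>2" for j
    by (simp add: power2_norm_eq_inner inner_diff_left inner_diff_right inner_add_left
        inner_add_right inner_commute algebra_simps)
  then have "(\<Sum>j=j1..j2. (norm (v + p + real j *\<^sub>R (h + q) - ?l j))\<^sup>2) =
      (\<Sum>j=j1..j2. (norm (v + real j *\<^sub>R h - ?l j))\<^sup>2)
      + 2 * (\<Sum>j=j1..j2. (v + real j *\<^sub>R h - ?l j) \<bullet> (p + real j *\<^sub>R q))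
      + (\<Sum>j=j1..j2. (norm (p + real j *\<^sub>R q))\<^sup>2)"
    by (simp only: sum.distrib sum_distrib_left)
  then have "data_fidelity j1 j2 L (v + p) (h + q) = data_fidelity j1 j2 L v h
      + (\<Sum>j=j1..j2. (v + real j *\<^sub>R h - ?l j) \<bullet> (p + real j *\<^sub>R q))
      + 1 / 2 * (\<Sum>j=j1..j2. (norm (p + real j *\<^sub>R q))\<^sup>2)"
    unfolding data_fidelity_def by simp
  moreover have "(\<Sum>j=j1..j2. (v + real j *\<^sub>R h - ?l j) \<bullet> (p + real j *\<^sub>R q)) =
      (fidelity_hessian j1 j2 x - fidelity_offset j1 j2 L) \<bullet> d"
    by (simp add: x d fidelity_offset_def fidelity_hessian_def scale_moment_def inner_sum_left inner_diff_left
        inner_diff_right inner_add_left inner_add_right sum.distrib sum_subtractf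
        sum_distrib_right sum_distrib_left power2_eq_square algebra_simps)
  moreover have "(\<Sum>j=j1..j2. (norm (p + real j *\<^sub>R q))\<^sup>2) = fidelity_hessian j1 j2 d \<bullet> d"
    unfolding power2_norm_eq_inner
    by (simp add: d fidelity_hessian_def scale_moment_def
        inner_add_left inner_add_right sum.distrib inner_commute[of q p]
        sum_distrib_right sum_distrib_left power2_eq_square algebra_simps)
  ultimately show ?thesis by (simp add: x d)
qed

lemma eigenvalue_symmetric_2:
  fixes a b c :: real
  assumes "(a - k) * (c - k) = b\<^sup>2"
  shows "eigenvalue (vector [vector [a, b], vector [b, c]] :: real ^ 2 ^ 2) k"
proof (cases "b = 0 \<and> a = k")
  case True
  have "(vector [1, 0] :: real ^ 2) \<noteq> 0" by (simp add: vec_eq_iff forall_2)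
  moreover have "(vector [vector [a, b], vector [b, c]] :: real ^ 2 ^ 2) *v vector [1, 0]
      = k *s vector [1, 0]"
    using True by (simp add: vec_eq_iff forall_2 matrix_vector_mult_def sum_2)
  ultimately show ?thesis unfolding eigenvalue_def by blast
next
  case False
  \<comment> \<open>This vector is orthogonal to the first row \<open>(a - k, b)\<close> of the singular matrix.\<close>
  then have "(vector [b, k - a] :: real ^ 2) \<noteq> 0" by (auto simp: vec_eq_iff forall_2)
  moreover have "(vector [vector [a, b], vector [b, c]] :: real ^ 2 ^ 2) *v vector [b, k - a]
      = k *s vector [b, k - a]"
    using assms
    by (simp add: vec_eq_iff forall_2 matrix_vector_mult_def sum_2 power2_eq_square algebra_simps)
  ultimately show ?thesis unfolding eigenvalue_def by blast
qed

text \<open>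
  The smallest eigenvalue bounds the quadratic form from below, also when the matrix acts on pairs of
  vectors instead of pairs of numbers.
\<close>

lemma lowest_eigenvalue_form_bound:
  fixes a b c :: real and p q :: "'a::real_inner"
  assumes low: "lowest_eigenvalue (vector [vector [a, b], vector [b, c]] :: real ^ 2 ^ 2) \<mu>"
  shows "\<mu> * ((norm p)\<^sup>2 + (norm q)\<^sup>2) \<le> a * (norm p)\<^sup>2 + 2 * b * (p \<bullet> q) + c * (norm q)\<^sup>2"
proof -
  \<comment> \<open>\<open>k\<close> is the smaller root of the characteristic polynomial, so both \<open>a - k\<close> and \<open>c - k\<close> are
     nonnegative and their product is \<open>b\<^sup>2\<close>.\<close>
  define s where "s = sqrt ((a - c)\<^sup>2 + 4 * b\<^sup>2)"
  define k where "k = (a + c - s) / 2"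
  have s_sq: "s\<^sup>2 = (a - c)\<^sup>2 + 4 * b\<^sup>2" by (simp add: s_def)
  have s_ge: "\<bar>a - c\<bar> \<le> s" unfolding s_def by (rule real_le_rsqrt) simp
  have prod: "(a - k) * (c - k) = b\<^sup>2"
    using s_sq by (simp add: k_def field_simps power2_eq_square)
  have nonneg: "0 \<le> a - k" "0 \<le> c - k" using s_ge by (auto simp: k_def)
  have "\<mu> \<le> k"
    using low eigenvalue_symmetric_2[OF prod] by (auto simp: lowest_eigenvalue_def)
  then have "\<mu> * ((norm p)\<^sup>2 + (norm q)\<^sup>2) \<le> k * ((norm p)\<^sup>2 + (norm q)\<^sup>2)"
    by (intro mult_right_mono) auto
  also have "\<dots> \<le> a * (norm p)\<^sup>2 + 2 * b * (p \<bullet> q) + c * (norm q)\<^sup>2"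
  proof -
    have "\<bar>b * (p \<bullet> q)\<bar> \<le> \<bar>b\<bar> * (norm p * norm q)"
      unfolding abs_mult by (intro mult_left_mono Cauchy_Schwarz_ineq2) auto
    also have "\<bar>b\<bar> = sqrt (a - k) * sqrt (c - k)"
      using prod by (simp flip: real_sqrt_mult)
    finally have "\<bar>2 * (b * (p \<bullet> q))\<bar> \<le> 2 * (sqrt (a - k) * norm p) * (sqrt (c - k) * norm q)"
      by (simp add: abs_mult mult_ac)
    also have "\<dots> \<le> (sqrt (a - k) * norm p)\<^sup>2 + (sqrt (c - k) * norm q)\<^sup>2"
      by (rule sum_squares_bound)
    also have "\<dots> = (a - k) * (norm p)\<^sup>2 + (c - k) * (norm q)\<^sup>2"
      using nonneg by (simp add: power_mult_distrib)
    finally have "\<bar>2 * (b * (p \<bullet> q))\<bar> \<le> (a - k) * (norm p)\<^sup>2 + (c - k) * (norm q)\<^sup>2" .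
    then show ?thesis by (simp add: algebra_simps abs_le_iff)
  qed
  finally show ?thesis .
qed

lemma fidelity_hessian_coercive:
  assumes "lowest_eigenvalue (scale_matrix j1 j2) \<mu>"
  shows "\<mu> * (norm d)\<^sup>2 \<le> fidelity_hessian j1 j2 d \<bullet> d"
proof -
  obtain p q where d: "d = (p, q)" by fastforce
  have "\<mu> * ((norm p)\<^sup>2 + (norm q)\<^sup>2) \<le> scale_moment j1 j2 0 * (norm p)\<^sup>2
      + 2 * scale_moment j1 j2 1 * (p \<bullet> q) + scale_moment j1 j2 2 * (norm q)\<^sup>2"
    using assms unfolding scale_matrix_def by (rule lowest_eigenvalue_form_bound)
  then show ?thesis
    by (simp add: d norm_Pair fidelity_hessian_def power2_norm_eq_inner inner_add_left
        inner_commute[of q p] algebra_simps)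
qed

section \<open>Convergence of the joint estimation iterates\<close>

lemma linear_map_prod:
  assumes "linear f" "linear g"
  shows "linear (map_prod f g)"
  using assms by (auto intro!: linearI simp: linear_add linear_cmul)

lemma norm_map_prod_le_onorm:
  fixes f :: "'a::euclidean_space \<Rightarrow> 'b::real_normed_vector"
  assumes "linear f"
  shows "norm (map_prod f f d) \<le> onorm f * norm d"
proof -
  obtain p q where d: "d = (p, q)" by fastforce
  have bl: "bounded_linear f" using assms by (rule linear_linear[THEN iffD2])
  have "(norm (f p))\<^sup>2 + (norm (f q))\<^sup>2 \<le> (onorm f * norm p)\<^sup>2 + (onorm f * norm q)\<^sup>2"
    by (intro add_mono power_mono onorm[OF bl]) auto
  also have "\<dots> = (onorm f)\<^sup>2 * ((norm p)\<^sup>2 + (norm q)\<^sup>2)"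
    by (simp add: power_mult_distrib distrib_left)
  finally have "norm (f p, f q) \<le> sqrt ((onorm f)\<^sup>2 * ((norm p)\<^sup>2 + (norm q)\<^sup>2))"
    by (simp add: norm_Pair)
  also have "\<dots> = onorm f * norm (p, q)"
    by (simp add: norm_Pair real_sqrt_mult onorm_pos_le[OF bl])
  finally show ?thesis by (simp add: d)
qed

theorem theorem3:
  fixes j1 j2 :: nat
    and L :: "nat \<Rightarrow> 'n::{finite,linorder} image"
    and lam \<alpha> \<mu> \<delta>0 \<nu>0 :: real
    and \<delta> \<nu> \<theta> :: "nat \<Rightarrow> real"
    and v h :: "nat \<Rightarrow> 'n image"
    and u ubar l lbar :: "nat \<Rightarrow> 'n image ^ 2"
  assumes N: "CARD('n) \<ge> 2"
    and j: "0 < j1" "j1 < j2"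
    and L_pos: "\<And>j n1 n2. j \<in> {j1..j2} \<Longrightarrow> L j $ n1 $ n2 > 0"
    and lam: "lam > 0" and \<alpha>: "\<alpha> > 0"
    and \<mu>: "\<mu> > 0" "lowest_eigenvalue (scale_matrix j1 j2) \<mu>"
    and steps: "\<delta>0 > 0" "\<nu>0 > 0"
      "\<delta>0 * \<nu>0 * (onorm (discrete_grad :: 'n image \<Rightarrow> 'n image ^ 2))\<^sup>2 < 1"
    and init_steps: "\<delta> 0 = \<delta>0" "\<nu> 0 = \<nu>0"
    and init_u: "u 0 = discrete_grad (v 0)" "ubar 0 = discrete_grad (v 0)"
    and init_l: "l 0 = discrete_grad (h 0)" "lbar 0 = discrete_grad (h 0)"
    and primal: "\<And>t. (v (Suc t), h (Suc t)) =
      prox (\<delta> t) (\<lambda>(v, h). ereal (data_fidelity j1 j2 L v h))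
        ((v t, h t) - \<delta> t *\<^sub>R (adjoint discrete_grad (ubar t), adjoint discrete_grad (lbar t)))"
    and dual_u: "\<And>t. u (Suc t) =
      prox (\<nu> t) (fenchel_conjugate (\<lambda>z. ereal (lam * mixed_norm z)))
        (u t + \<nu> t *\<^sub>R discrete_grad (v (Suc t)))"
    and dual_l: "\<And>t. l (Suc t) =
      prox (\<nu> t) (fenchel_conjugate (\<lambda>z. ereal (lam * \<alpha> * mixed_norm z)))
        (l t + \<nu> t *\<^sub>R discrete_grad (h (Suc t)))"
    and step_\<theta>: "\<And>t. \<theta> t = (1 + 2 * \<mu> * \<delta> t) powr (- 1 / 2)"
    and step_\<delta>: "\<And>t. \<delta> (Suc t) = \<theta> t * \<delta> t"
    and step_\<nu>: "\<And>t. \<nu> (Suc t) = \<nu> t / \<theta> t"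
    and extrapolation: "\<And>t. (ubar (Suc t), lbar (Suc t)) =
      (u (Suc t), l (Suc t)) + \<theta> t *\<^sub>R ((u (Suc t), l (Suc t)) - (u t, l t))"
  shows "\<exists>sol. is_arg_min (joint_objective j1 j2 L lam \<alpha>) (\<lambda>_. True) sol
    \<and> (\<lambda>t. (v t, h t)) \<longlonglongrightarrow> sol"
proof -
  define x where "x t = (v t, h t)" for t
  define y where "y t = (u t, l t)" for t
  define yb where "yb t = (ubar t, lbar t)" for t
  let ?D = "discrete_grad :: 'n image \<Rightarrow> 'n image ^ 2"
  let ?K = "map_prod ?D ?D"
  let ?M = "fidelity_hessian j1 j2 :: 'n image \<times> 'n image \<Rightarrow> 'n image \<times> 'n image"
  let ?b = "fidelity_offset j1 j2 L"
  let ?\<Phi> = "case_prod (data_fidelity j1 j2 L)"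
  define Fu where "Fu = (\<lambda>z :: 'n image ^ 2. lam * mixed_norm z)"
  define Fl where "Fl = (\<lambda>z :: 'n image ^ 2. lam * \<alpha> * mixed_norm z)"
  define C where "C = dual_ball Fu \<times> dual_ball Fl"
  note step_pos = accelerated_step_sizes[where \<mu> = \<mu> and \<tau> = \<delta> and \<sigma> = \<nu> and \<theta> = \<theta>,
      OF \<mu>(1) _ _ step_\<theta> step_\<delta> step_\<nu>]
  have \<delta>_pos: "\<delta> t > 0" and \<nu>_pos: "\<nu> t > 0" for t
    using step_pos(1,2)[of t] steps init_steps by simp_all

  have linK: "linear ?K" by (rule linear_map_prod[OF linear_discrete_grad linear_discrete_grad])
  have K_bound: "norm (?K d) \<le> onorm ?D * norm d" for d
    by (rule norm_map_prod_le_onorm[OF linear_discrete_grad])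
  have coercive: "\<mu> * (norm d)\<^sup>2 \<le> ?M d \<bullet> d" for d :: "'n image \<times> 'n image"
    by (rule fidelity_hessian_coercive[OF \<mu>(2)])
  have M_pos: "0 < ?M d \<bullet> d" if "d \<noteq> 0" for d :: "'n image \<times> 'n image"
    using coercive[of d] \<mu>(1) that by (smt (verit) mult_pos_pos zero_less_norm_iff zero_less_power)
  have M_nonneg: "0 \<le> ?M d \<bullet> d" for d :: "'n image \<times> 'n image"
    using M_pos[of d] by (cases "d = 0") (auto intro: less_imp_le)
  note expand = data_fidelity_expansion[of j1 j2 L]

  have hom: "Fu (c *\<^sub>R z) = c * Fu z" "Fl (c *\<^sub>R z) = c * Fl z" if "c \<ge> 0" for c z
    using that by (simp_all add: Fu_def Fl_def mixed_norm_scaleR)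
  have nonneg: "0 \<le> Fu z" "0 \<le> Fl z" for z
    using lam \<alpha> by (simp_all add: Fu_def Fl_def mixed_norm_nonneg)
  have cont: "continuous_on UNIV Fu" "continuous_on UNIV Fl"
    unfolding Fu_def Fl_def by (intro continuous_intros continuous_on_mixed_norm)+
  have ball: "closed (dual_ball F)" "convex (dual_ball F)" for F :: "'n image ^ 2 \<Rightarrow> real"
    by (rule closed_dual_ball convex_dual_ball)+
  have "0 \<in> dual_ball Fu" "0 \<in> dual_ball Fl"
    using nonneg by (auto intro: zero_in_dual_ball)
  then have ball_ne: "dual_ball Fu \<noteq> {}" "dual_ball Fl \<noteq> {}" by blast+
  have ball_compact: "compact (dual_ball Fu)" "compact (dual_ball Fl)"
    unfolding compact_eq_bounded_closed using ball(1) bounded_dual_ball cont by blast+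
  have C: "compact C" "convex C" "C \<noteq> {}"
    unfolding C_def by (simp_all add: compact_Times convex_Times ball ball_ne ball_compact)

  obtain xs ys where saddle: "\<And>d. (?M xs - ?b) \<bullet> d + ?K d \<bullet> ys = 0" "ys \<in> C"
    "\<And>z. z \<in> C \<Longrightarrow> ?K xs \<bullet> (z - ys) \<le> 0"
    using saddle_point_exists[OF linear_fidelity_hessian M_pos linK C] by metis

  have "is_arg_min (\<lambda>z. ?\<Phi> z + (Fu (fst (?K z)) + Fl (snd (?K z)))) (\<lambda>_. True) xs"
  proof (rule saddle_point_minimizes[where \<Phi> = ?\<Phi> and F = "\<lambda>w. Fu (fst w) + Fl (snd w)",
        OF linK M_nonneg expand saddle])
    show "w \<bullet> z \<le> Fu (fst w) + Fl (snd w)" if "z \<in> C" for w z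
      using that by (auto simp: C_def dual_ball_def inner_prod_def intro!: add_mono)
    obtain p where "p \<in> dual_ball Fu" "fst (?K xs) \<bullet> p = Fu (fst (?K xs))"
      using mixed_norm_attained[of lam "fst (?K xs)"] lam by (auto simp: Fu_def dual_ball_def)
    moreover obtain q where "q \<in> dual_ball Fl" "snd (?K xs) \<bullet> q = Fl (snd (?K xs))"
      using mixed_norm_attained[of "lam * \<alpha>" "snd (?K xs)"] lam \<alpha> by (auto simp: Fl_def dual_ball_def)
    ultimately show "\<exists>z\<in>C. ?K xs \<bullet> z = Fu (fst (?K xs)) + Fl (snd (?K xs))"
      by (intro bexI[of _ "(p, q)"]) (auto simp: C_def inner_prod_def)
  qed
  moreover have "(\<lambda>z. ?\<Phi> z + (Fu (fst (?K z)) + Fl (snd (?K z)))) = joint_objective j1 j2 L lam \<alpha>"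
    by (auto simp: joint_objective_def Fu_def Fl_def algebra_simps)
  ultimately have opt: "is_arg_min (joint_objective j1 j2 L lam \<alpha>) (\<lambda>_. True) xs" by simp

  have primal_step: "(x t - x (Suc t)) \<bullet> d = \<delta> t * ((?M (x (Suc t)) - ?b) \<bullet> d + ?K d \<bullet> yb t)" for t d
  proof -
    define w where "w = (adjoint ?D (ubar t), adjoint ?D (lbar t))"
    have "x (Suc t) = prox (\<delta> t) (\<lambda>z. ereal (?\<Phi> z)) (x t - \<delta> t *\<^sub>R w)"
      using primal[of t] by (simp add: x_def w_def case_prod_unfold)
    then have "x t - \<delta> t *\<^sub>R w - x (Suc t) = \<delta> t *\<^sub>R (?M (x (Suc t)) - ?b)"
      using prox_quadratic[where x = "x t - \<delta> t *\<^sub>R w" and \<Phi> = ?\<Phi>,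
          OF linear_fidelity_hessian M_nonneg \<delta>_pos[of t] expand]
      by simp
    then have "x t - x (Suc t) = \<delta> t *\<^sub>R (?M (x (Suc t)) - ?b + w)"
      by (simp add: algebra_simps)
    moreover have "w \<bullet> d = ?K d \<bullet> yb t"
      by (cases d) (simp add: w_def yb_def adjoint_clauses(2)[OF linear_discrete_grad]
          inner_commute[of "ubar t"] inner_commute[of "lbar t"])
    ultimately show ?thesis by (simp add: inner_add_left)
  qed
  have dual_step: "y (Suc t) \<in> C"
    "z \<in> C \<Longrightarrow> (y t + \<nu> t *\<^sub>R ?K (x (Suc t)) - y (Suc t)) \<bullet> (z - y (Suc t)) \<le> 0" for t z
  proof -
    have u: "u (Suc t) = closest_point (dual_ball Fu) (u t + \<nu> t *\<^sub>R ?D (v (Suc t)))"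
      using dual_u[of t] prox_conjugate_homogeneous[where F = Fu, OF hom(1) nonneg(1) \<nu>_pos[of t]]
      by (simp add: Fu_def)
    have l: "l (Suc t) = closest_point (dual_ball Fl) (l t + \<nu> t *\<^sub>R ?D (h (Suc t)))"
      using dual_l[of t] prox_conjugate_homogeneous[where F = Fl, OF hom(2) nonneg(2) \<nu>_pos[of t]]
      by (simp add: Fl_def)
    show "y (Suc t) \<in> C"
      unfolding y_def C_def u l by (simp add: closest_point_in_set ball ball_ne)
    assume "z \<in> C"
    then have z: "fst z \<in> dual_ball Fu" "snd z \<in> dual_ball Fl" by (auto simp: C_def)
    have "(u t + \<nu> t *\<^sub>R ?D (v (Suc t)) - u (Suc t)) \<bullet> (fst z - u (Suc t)) \<le> 0"
      unfolding u by (intro closest_point_dot ball z)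
    moreover have "(l t + \<nu> t *\<^sub>R ?D (h (Suc t)) - l (Suc t)) \<bullet> (snd z - l (Suc t)) \<le> 0"
      unfolding l by (intro closest_point_dot ball z)
    ultimately show "(y t + \<nu> t *\<^sub>R ?K (x (Suc t)) - y (Suc t)) \<bullet> (z - y (Suc t)) \<le> 0"
      by (simp add: x_def y_def inner_prod_def)
  qed

  have mono: "\<mu> * (norm (p - q))\<^sup>2 \<le> ((?M p - ?b) - (?M q - ?b)) \<bullet> (p - q)" for p q
    using coercive[of "p - q"] by (simp add: linear_diff[OF linear_fidelity_hessian])
  have yb: "yb 0 = y 0" "yb (Suc t) = y (Suc t) + \<theta> t *\<^sub>R (y (Suc t) - y t)" for t
    using extrapolation[of t] by (simp_all add: yb_def y_def init_u init_l)
  have small: "\<delta> 0 * \<nu> 0 * (onorm ?D)\<^sup>2 < 1" using steps(3) init_steps by simp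
  have "x \<longlonglongrightarrow> xs"
    by (rule accelerated_primal_dual_converges[where K = ?K and A = "\<lambda>z. ?M z - ?b"
        and k = "onorm ?D" and \<tau> = \<delta> and \<sigma> = \<nu> and \<theta> = \<theta> and \<mu> = \<mu> and x = x and y = y
        and yb = yb and C = C and xs = xs and ys = ys,
        OF linK K_bound mono \<mu>(1) \<delta>_pos \<nu>_pos small step_\<theta> step_\<delta> step_\<nu> saddle primal_step dual_step yb])
  with opt show ?thesis unfolding x_def by blast
qed

end
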